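(* Let $R$ be either the field $\mathbb R$ of real numbers or the field $\mathbb C$ of complex numbers. Let $G(z,w)$ be a formal power series in indeterminates $z$ and $w=(w_i)_{i\in I}$, with coefficients in $R$, satisfying $G(0,0)=0$ and $|(\partial G/\partial z)(0,0)|<1$. Then there exists a unique formal power series $\varphi(w)$ (with coefficients in $R$) with zero constant term satisfying $\varphi(w)=G(\varphi(w),w)$, and its coefficients are given by the absolutely convergent sums $$[w^\alpha]\varphi(w)=\sum_{m=1}^\infty\frac1m\,[\zeta^{m-1}w^\alpha]\,G(\zeta,w)^m.$$ More generally, if $H(z,w)$ is any formal power series (in the same indeterminates, with coefficients in $R$), we have $$[w^\alpha]H(\varphi(w),w)=[w^\alpha]H(0,w)+\sum_{m=1}^\infty\frac1m\,[\zeta^{m-1}w^\alpha]\,\frac{\partial H(\zeta,w)}{\partial\zeta}\,G(\zeta,w)^m.$$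
   Context: $I$ is an arbitrary finite or infinite index set. Here $\alpha=(\alpha_i)_{i\in I}$ ranges over multi-indices of nonnegative integers with finitely many nonzero entries, and $w^\alpha=\prod_i w_i^{\alpha_i}$. $[w^\alpha]$ and $[\zeta^n w^\alpha]$ denote extraction of the coefficient of the indicated monomial from the whole formal power series written to the right. $(\partial G/\partial z)(0,0)$ is the coefficient of $z$ in $G$. *)

theory Defs
  imports
    "HOL-Analysis.Analysis"
    "HOL-Computational_Algebra.Formal_Power_Series"
    "HOL-Library.Poly_Mapping"
    "HOL-Library.Groups_Big_Fun"
begin

text \<open>
  Formal power series in a possibly infinite family of indeterminates \<open>w i\<close>. The multi-indices are
  the finitely supported functions \<open>'i \<Rightarrow>\<^sub>0 nat\<close>; infinitely many coefficients may be nonzero, even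
  within a single total degree. The field of real or complex numbers appears as a coefficient type of
  class \<open>{real_normed_field, banach}\<close>: the norm of that class is multiplicative, so by the theorems
  of Ostrowski and Gelfand--Mazur its instances are, up to isometric isomorphism, exactly the reals
  and the complex numbers.
\<close>

typedef ('i, 'a) mfps = "UNIV :: (('i \<Rightarrow>\<^sub>0 nat) \<Rightarrow> 'a) set"
  morphisms mfps_nth Abs_mfps
  by simp

lemma mfps_nth_Abs_mfps [simp]: "mfps_nth (Abs_mfps f) = f"
  by (simp add: Abs_mfps_inverse)

lemma mfps_eqI: "(\<And>\<alpha>. mfps_nth f \<alpha> = mfps_nth g \<alpha>) \<Longrightarrow> f = g"
  by (metis ext mfps_nth_inject)

definition splits :: "('i \<Rightarrow>\<^sub>0 nat) \<Rightarrow> (('i \<Rightarrow>\<^sub>0 nat) \<times> ('i \<Rightarrow>\<^sub>0 nat)) set" where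
  "splits \<alpha> = {(\<beta>, \<gamma>). \<beta> + \<gamma> = \<alpha>}"

lemma finite_splits [simp]: "finite (splits \<alpha>)"
proof -
  let ?B = "\<Union>i\<in>Poly_Mapping.keys \<alpha>. {..Poly_Mapping.lookup \<alpha> i}"
  let ?F = "{f. \<forall>i. (i \<in> Poly_Mapping.keys \<alpha> \<longrightarrow> f i \<in> ?B) \<and> (i \<notin> Poly_Mapping.keys \<alpha> \<longrightarrow> f i = (0::nat))}"
  have "Poly_Mapping.lookup ` fst ` splits \<alpha> \<subseteq> ?F"
  proof (clarify, intro conjI impI)
    fix \<beta> \<gamma> i assume "(\<beta>, \<gamma>) \<in> splits \<alpha>"
    hence *: "Poly_Mapping.lookup \<alpha> i = Poly_Mapping.lookup \<beta> i + Poly_Mapping.lookup \<gamma> i"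
      by (auto simp: splits_def lookup_add)
    show "Poly_Mapping.lookup (fst (\<beta>, \<gamma>)) i \<in> ?B" if "i \<in> Poly_Mapping.keys \<alpha>"
      using that * by (intro UN_I[of i]) auto
    show "Poly_Mapping.lookup (fst (\<beta>, \<gamma>)) i = 0" if "i \<notin> Poly_Mapping.keys \<alpha>"
      using that * by (simp add: in_keys_iff)
  qed
  moreover have "finite ?F"
    by (intro finite_set_of_finite_funs) auto
  ultimately have "finite (Poly_Mapping.lookup ` fst ` splits \<alpha>)"
    by (rule finite_subset)
  hence fin: "finite (fst ` splits \<alpha>)"
    by (rule finite_imageD) (auto intro!: inj_onI poly_mapping_eqI)
  have "inj_on fst (splits \<alpha>)"
    by (auto simp: inj_on_def splits_def)
  thus ?thesis
    using fin finite_imageD by blast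
qed

lemma splits_0 [simp]: "splits 0 = {(0, 0)}"
proof -
  have "\<beta> = 0 \<and> \<gamma> = 0" if "\<beta> + \<gamma> = 0" for \<beta> \<gamma> :: "'i \<Rightarrow>\<^sub>0 nat"
  proof -
    have "Poly_Mapping.lookup \<beta> i + Poly_Mapping.lookup \<gamma> i = 0" for i
      using that by (metis lookup_add lookup_zero)
    thus ?thesis by (auto intro!: poly_mapping_eqI)
  qed
  thus ?thesis by (auto simp: splits_def)
qed

instantiation mfps :: (type, comm_ring_1) comm_ring_1
begin

definition zero_mfps :: "('a, 'b) mfps" where
  "0 = Abs_mfps (\<lambda>_. 0)"

definition one_mfps :: "('a, 'b) mfps" where
  "1 = Abs_mfps (\<lambda>\<alpha>. if \<alpha> = 0 then 1 else 0)"

definition plus_mfps :: "('a, 'b) mfps \<Rightarrow> ('a, 'b) mfps \<Rightarrow> ('a, 'b) mfps" where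
  "f + g = Abs_mfps (\<lambda>\<alpha>. mfps_nth f \<alpha> + mfps_nth g \<alpha>)"

definition uminus_mfps :: "('a, 'b) mfps \<Rightarrow> ('a, 'b) mfps" where
  "- f = Abs_mfps (\<lambda>\<alpha>. - mfps_nth f \<alpha>)"

definition minus_mfps :: "('a, 'b) mfps \<Rightarrow> ('a, 'b) mfps \<Rightarrow> ('a, 'b) mfps" where
  "f - g = Abs_mfps (\<lambda>\<alpha>. mfps_nth f \<alpha> - mfps_nth g \<alpha>)"

definition times_mfps :: "('a, 'b) mfps \<Rightarrow> ('a, 'b) mfps \<Rightarrow> ('a, 'b) mfps" where
  "f * g = Abs_mfps (\<lambda>\<alpha>. \<Sum>(\<beta>, \<gamma>)\<in>splits \<alpha>. mfps_nth f \<beta> * mfps_nth g \<gamma>)"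

instance
proof
  fix a b c :: "('a, 'b) mfps"
  show "a * b * c = a * (b * c)"
  proof (rule mfps_eqI)
    fix \<alpha>
    have "mfps_nth (a * b * c) \<alpha> = (\<Sum>((\<delta>, \<epsilon>), (\<beta>, \<gamma>)) \<in> (SIGMA p:splits \<alpha>. splits (fst p)).
            mfps_nth a \<beta> * mfps_nth b \<gamma> * mfps_nth c \<epsilon>)"
      by (simp add: times_mfps_def sum_distrib_right case_prod_unfold sum.Sigma)
    also have "\<dots> = (\<Sum>((\<beta>, \<delta>), (\<gamma>, \<epsilon>)) \<in> (SIGMA p:splits \<alpha>. splits (snd p)).
            mfps_nth a \<beta> * (mfps_nth b \<gamma> * mfps_nth c \<epsilon>))"
      by (rule sum.reindex_bij_witness[of _
            "\<lambda>((\<beta>, \<delta>), (\<gamma>, \<epsilon>)). ((\<beta> + \<gamma>, \<epsilon>), (\<beta>, \<gamma>))"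
            "\<lambda>((\<delta>, \<epsilon>), (\<beta>, \<gamma>)). ((\<beta>, \<gamma> + \<epsilon>), (\<gamma>, \<epsilon>))"])
         (auto simp: splits_def add_ac)
    also have "\<dots> = mfps_nth (a * (b * c)) \<alpha>"
      by (simp add: times_mfps_def sum_distrib_left case_prod_unfold sum.Sigma)
    finally show "mfps_nth (a * b * c) \<alpha> = mfps_nth (a * (b * c)) \<alpha>" .
  qed
  show "a * b = b * a"
  proof (rule mfps_eqI)
    fix \<alpha>
    show "mfps_nth (a * b) \<alpha> = mfps_nth (b * a) \<alpha>"
      unfolding times_mfps_def mfps_nth_Abs_mfps
      by (rule sum.reindex_bij_witness[of _ prod.swap prod.swap])
         (auto simp: splits_def add.commute mult.commute)
  qed
  show "1 * a = a"
  proof (rule mfps_eqI)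
    fix \<alpha>
    have "mfps_nth (1 * a) \<alpha> = (\<Sum>(\<beta>, \<gamma>)\<in>{(0, \<alpha>)}. mfps_nth 1 \<beta> * mfps_nth a \<gamma>)"
      unfolding times_mfps_def mfps_nth_Abs_mfps
      by (rule sum.mono_neutral_right, rule finite_splits)
         (auto simp: splits_def one_mfps_def split: if_splits)
    thus "mfps_nth (1 * a) \<alpha> = mfps_nth a \<alpha>"
      by (simp add: one_mfps_def)
  qed
  show "(a + b) * c = a * c + b * c"
    by (rule mfps_eqI)
       (simp add: times_mfps_def plus_mfps_def case_prod_unfold distrib_right sum.distrib)
  show "(0::('a, 'b) mfps) \<noteq> 1"
  proof
    assume "(0::('a, 'b) mfps) = 1"
    hence "mfps_nth (0::('a, 'b) mfps) 0 = mfps_nth 1 0" by simp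
    thus False by (simp add: zero_mfps_def one_mfps_def)
  qed
qed (auto intro!: mfps_eqI simp: zero_mfps_def plus_mfps_def uminus_mfps_def minus_mfps_def add_ac)

end

lemma mfps_nth_zero [simp]: "mfps_nth 0 \<alpha> = 0"
  and mfps_nth_one: "mfps_nth 1 \<alpha> = (if \<alpha> = 0 then 1 else 0)"
  and mfps_nth_add [simp]: "mfps_nth (f + g) \<alpha> = mfps_nth f \<alpha> + mfps_nth g \<alpha>"
  and mfps_nth_uminus [simp]: "mfps_nth (- f) \<alpha> = - mfps_nth f \<alpha>"
  and mfps_nth_diff [simp]: "mfps_nth (f - g) \<alpha> = mfps_nth f \<alpha> - mfps_nth g \<alpha>"
  and mfps_nth_mult: "mfps_nth (f * g) \<alpha> = (\<Sum>(\<beta>, \<gamma>)\<in>splits \<alpha>. mfps_nth f \<beta> * mfps_nth g \<gamma>)"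
  by (simp_all add: zero_mfps_def one_mfps_def plus_mfps_def uminus_mfps_def minus_mfps_def
        times_mfps_def)

text \<open>
  A power series in \<open>z\<close> and \<open>w\<close> is represented as a power series in \<open>z\<close> whose coefficients are
  power series in \<open>w\<close>, i.e. \<open>R[[z, w]]\<close> is identified with \<open>R[[w]][[z]]\<close>. Under this
  identification \<^const>\<open>fps_deriv\<close> is the partial derivative with respect to \<open>z\<close>.
\<close>

definition zw_coeff :: "('i, 'a) mfps fps \<Rightarrow> nat \<Rightarrow> ('i \<Rightarrow>\<^sub>0 nat) \<Rightarrow> 'a" where
  "zw_coeff F n \<alpha> = mfps_nth (fps_nth F n) \<alpha>"

text \<open>
  The type \<^typ>\<open>'i\<close> is never empty, so the index set \<open>I\<close> is a set over this type: the following
  are the power series in which only the indeterminates \<open>w i\<close> with \<open>i \<in> I\<close> occur.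
\<close>

definition w_series :: "'i set \<Rightarrow> ('i, 'a::zero) mfps set" where
  "w_series I = {f. \<forall>\<alpha>. mfps_nth f \<alpha> \<noteq> 0 \<longrightarrow> Poly_Mapping.keys \<alpha> \<subseteq> I}"

definition zw_series :: "'i set \<Rightarrow> ('i, 'a::zero) mfps fps set" where
  "zw_series I = {F. \<forall>n. fps_nth F n \<in> w_series I}"

text \<open>
  The substitution \<open>F(\<phi>(w), w) = \<Sum>n. F\<^sub>n(w) \<phi>(w)^n\<close>. If \<open>\<phi>\<close> has zero constant term, then for
  every fixed multi-index only finitely many \<open>n\<close> contribute (lemma \<open>finite_subst_z\<close>); otherwise
  the value is meaningless.
\<close>

definition subst_z :: "('i, 'a::comm_ring_1) mfps fps \<Rightarrow> ('i, 'a) mfps \<Rightarrow> ('i, 'a) mfps" where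
  "subst_z F \<phi> = Abs_mfps (\<lambda>\<alpha>. Sum_any (\<lambda>n. mfps_nth (fps_nth F n * \<phi> ^ n) \<alpha>))"

definition total_degree :: "('i \<Rightarrow>\<^sub>0 nat) \<Rightarrow> nat" where
  "total_degree \<alpha> = (\<Sum>i\<in>Poly_Mapping.keys \<alpha>. Poly_Mapping.lookup \<alpha> i)"

lemma total_degree_add: "total_degree (\<beta> + \<gamma>) = total_degree \<beta> + total_degree \<gamma>"
proof -
  let ?K = "Poly_Mapping.keys \<beta> \<union> Poly_Mapping.keys \<gamma>"
  have *: "total_degree \<alpha> = (\<Sum>i\<in>?K. Poly_Mapping.lookup \<alpha> i)" if "Poly_Mapping.keys \<alpha> \<subseteq> ?K" for \<alpha>
    unfolding total_degree_def using that
    by (intro sum.mono_neutral_left) (auto simp: in_keys_iff)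
  show ?thesis
    by (simp add: * keys_add lookup_add sum.distrib)
qed

lemma total_degree_eq_0_iff: "total_degree \<alpha> = 0 \<longleftrightarrow> \<alpha> = 0"
  by (auto simp: total_degree_def in_keys_iff intro!: poly_mapping_eqI)

lemma mfps_nth_power_eq_0:
  fixes \<phi> :: "('i, 'a::comm_ring_1) mfps"
  assumes "mfps_nth \<phi> 0 = 0" and "total_degree \<alpha> < n"
  shows "mfps_nth (\<phi> ^ n) \<alpha> = 0"
  using assms(2)
proof (induction n arbitrary: \<alpha>)
  case (Suc n)
  have "mfps_nth \<phi> \<beta> * mfps_nth (\<phi> ^ n) \<gamma> = 0" if "(\<beta>, \<gamma>) \<in> splits \<alpha>" for \<beta> \<gamma>
  proof (cases "\<beta> = 0")
    case True
    thus ?thesis using assms(1) by simp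
  next
    case False
    hence "total_degree \<gamma> < total_degree \<alpha>"
      using that total_degree_eq_0_iff[of \<beta>] by (auto simp: splits_def total_degree_add)
    thus ?thesis using Suc by simp
  qed
  thus ?case
    by (auto simp: mfps_nth_mult intro!: sum.neutral)
qed simp

lemma finite_subst_z:
  fixes \<phi> :: "('i, 'a::comm_ring_1) mfps"
  assumes "mfps_nth \<phi> 0 = 0"
  shows "finite {n. mfps_nth (fps_nth F n * \<phi> ^ n) \<alpha> \<noteq> 0}"
proof (rule finite_subset[OF _ finite_atMost[of "total_degree \<alpha>"]], safe)
  fix n assume nz: "mfps_nth (fps_nth F n * \<phi> ^ n) \<alpha> \<noteq> 0"
  show "n \<le> total_degree \<alpha>"
  proof (rule ccontr)
    assume "\<not> n \<le> total_degree \<alpha>"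
    hence "mfps_nth (\<phi> ^ n) \<gamma> = 0" if "(\<beta>, \<gamma>) \<in> splits \<alpha>" for \<beta> \<gamma>
      using that assms by (intro mfps_nth_power_eq_0) (auto simp: splits_def total_degree_add)
    hence "mfps_nth (fps_nth F n * \<phi> ^ n) \<alpha> = 0"
      by (auto simp: mfps_nth_mult intro!: sum.neutral)
    with nz show False by simp
  qed
qed

end

theory Submission
  imports Defs
begin

text \<open>
  Write \<open>K\<close> for the ring of power series in \<open>w\<close>, so that \<open>G\<close> and \<open>H\<close> are power series in \<open>\<zeta>\<close> over
  \<open>K\<close>, and let \<open>a = (\<partial>G/\<partial>z)(0,0)\<close>. Everything rests on the functional
  \<open>M(H) = \<Sum>m. [\<zeta>^m] H G^m\<close> with values in \<open>K\<close> (\<open>diagonal_sum\<close>).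

  The sums converge absolutely, coefficient by coefficient in \<open>w\<close>. Indeed, if a monomial \<open>\<zeta>^n w^\<beta>\<close>
  has weight \<open>n + 2|\<beta>|\<close>, then \<open>G = a\<zeta> + B\<close> where all monomials of \<open>B\<close> have weight at least \<open>2\<close>. In the
  binomial expansion of \<open>(a\<zeta> + B)^m\<close>, the powers of \<open>B\<close> beyond \<open>2|\<alpha>|\<close> cannot contribute to
  \<open>[\<zeta>^m w^\<alpha>]\<close>, so what remains is a finite combination of the sequences \<open>(m choose j) a^(m - j)\<close>,
  which are summable in \<open>m\<close> because \<open>|a| < 1\<close> (\<open>diagonal_coeff_expansion\<close>, \<open>summable_norm_diagonal\<close>).

  The functional \<open>M\<close> is \<open>K\<close>-linear, and shifting the summation index shows that it kills every
  multiple of \<open>\<zeta> - G\<close>. Let \<open>\<phi> = G(\<phi>)\<close>. Dividing \<open>G - G(\<phi>)\<close> by \<open>\<zeta> - \<phi>\<close> gives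
  \<open>\<zeta> - G = (\<zeta> - \<phi>) (1 - Q)\<close> with \<open>Q(0,0) = a \<noteq> 1\<close>; thus \<open>\<zeta> - \<phi>\<close> is a multiple of \<open>\<zeta> - G\<close>, and since
  \<open>H - H(\<phi>)\<close> is a multiple of \<open>\<zeta> - \<phi>\<close>, it follows that \<open>M(H F) = H(\<phi>) M(F)\<close>
  (\<open>diagonal_sum_mult\<close>). Finally, the derivative of \<open>H G^m\<close> yields
  \<open>1/m [\<zeta>^(m-1)] H' G^m = [\<zeta>^m] H G^m - [\<zeta>^(m-1)] H G' G^(m-1)\<close>,
  so the sum in the theorem is \<open>M(H (1 - G')) - H(0) = H(\<phi>) M(1 - G') - H(0)\<close>. For \<open>H = 1\<close> all
  its terms vanish, whence \<open>M(1 - G') = 1\<close>, and the formula follows for all \<open>H\<close>.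

  The case \<open>H = \<zeta>\<close> expresses \<open>\<phi>\<close> through \<open>G\<close>, which gives uniqueness. A fixed point exists because the
  iteration \<open>\<phi> \<mapsto> \<phi> + (G(\<phi>) - \<phi>) / (1 - a)\<close> determines one more total degree in every step.
\<close>

section \<open>Constants and orders of vanishing\<close>

lemma mfps_nth_sum: "mfps_nth (\<Sum>x\<in>A. f x) \<alpha> = (\<Sum>x\<in>A. mfps_nth (f x) \<alpha>)"
  by (induction A rule: infinite_finite_induct) auto

definition mfps_const :: "'a::comm_ring_1 \<Rightarrow> ('i, 'a) mfps" where
  "mfps_const c = Abs_mfps (\<lambda>\<alpha>. if \<alpha> = 0 then c else 0)"

lemma mfps_nth_const: "mfps_nth (mfps_const c) \<alpha> = (if \<alpha> = 0 then c else 0)"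
  by (simp add: mfps_const_def)

lemma mfps_nth_const_mult [simp]:
  fixes f :: "('i, 'a::comm_ring_1) mfps"
  shows "mfps_nth (mfps_const c * f) \<alpha> = c * mfps_nth f \<alpha>"
proof -
  have "mfps_nth (mfps_const c * f) \<alpha> = (\<Sum>(\<beta>, \<gamma>)\<in>{(0, \<alpha>)}.
      mfps_nth (mfps_const c :: ('i, 'a) mfps) \<beta> * mfps_nth f \<gamma>)"
    unfolding mfps_nth_mult
    by (rule sum.mono_neutral_right, rule finite_splits)
       (auto simp: splits_def mfps_nth_const split: if_splits)
  thus ?thesis by (simp add: mfps_nth_const)
qed

lemma mfps_const_one: "mfps_const 1 = 1"
  by (rule mfps_eqI) (simp add: mfps_nth_const mfps_nth_one)

lemma mfps_const_mult: "mfps_const (c * d) = mfps_const c * mfps_const d"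
  by (rule mfps_eqI) (simp add: mfps_nth_const)

lemma mfps_const_power: "mfps_const (c ^ n) = mfps_const c ^ n"
  by (induction n) (simp_all add: mfps_const_one mfps_const_mult)

lemma of_nat_mfps: "of_nat n = mfps_const (of_nat n)"
  by (induction n) (auto intro!: mfps_eqI simp: mfps_nth_const mfps_nth_one)

lemma mfps_nth_mult_0: "mfps_nth (f * g) 0 = mfps_nth f 0 * mfps_nth g 0"
  by (simp add: mfps_nth_mult)

definition order_ge :: "nat \<Rightarrow> ('i, 'a::comm_ring_1) mfps \<Rightarrow> bool" where
  "order_ge n f \<longleftrightarrow> (\<forall>\<alpha>. total_degree \<alpha> < n \<longrightarrow> mfps_nth f \<alpha> = 0)"

lemma order_ge_0 [simp]: "order_ge 0 f"
  by (simp add: order_ge_def)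

lemma order_ge_1_iff: "order_ge (Suc 0) f \<longleftrightarrow> mfps_nth f 0 = 0"
  by (simp add: order_ge_def total_degree_eq_0_iff)

lemma order_ge_mono: "order_ge n f \<Longrightarrow> m \<le> n \<Longrightarrow> order_ge m f"
  by (auto simp: order_ge_def)

lemma order_ge_diff: "order_ge n f \<Longrightarrow> order_ge n g \<Longrightarrow> order_ge n (f - g)"
  and order_ge_add: "order_ge n f \<Longrightarrow> order_ge n g \<Longrightarrow> order_ge n (f + g)"
  by (auto simp: order_ge_def)

lemma order_ge_mult:
  assumes "order_ge m f" "order_ge n g"
  shows "order_ge (m + n) (f * g)"
  unfolding order_ge_def
proof (intro allI impI)
  fix \<alpha> :: "'a \<Rightarrow>\<^sub>0 nat"
  assume \<alpha>: "total_degree \<alpha> < m + n"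
  have "mfps_nth f \<beta> * mfps_nth g \<gamma> = 0" if "(\<beta>, \<gamma>) \<in> splits \<alpha>" for \<beta> \<gamma>
  proof -
    have "total_degree \<beta> < m \<or> total_degree \<gamma> < n"
      using that \<alpha> by (auto simp: splits_def total_degree_add)
    thus ?thesis using assms by (auto simp: order_ge_def)
  qed
  thus "mfps_nth (f * g) \<alpha> = 0"
    by (auto simp: mfps_nth_mult intro!: sum.neutral)
qed

lemma order_ge_all_imp_0:
  assumes "\<And>n. order_ge n f"
  shows "f = 0"
proof (rule mfps_eqI)
  fix \<alpha>
  show "mfps_nth f \<alpha> = mfps_nth 0 \<alpha>"
    using assms[of "Suc (total_degree \<alpha>)"] by (simp add: order_ge_def)
qed

section \<open>Substitution\<close>

lemma mfps_nth_subst_z: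
  assumes "mfps_nth \<phi> 0 = 0" and "total_degree \<alpha> \<le> N"
  shows "mfps_nth (subst_z F \<phi>) \<alpha> = mfps_nth (\<Sum>n\<le>N. fps_nth F n * \<phi> ^ n) \<alpha>"
proof -
  have "mfps_nth (fps_nth F n * \<phi> ^ n) \<alpha> = 0" if "n > N" for n
  proof -
    have "order_ge n (\<phi> ^ n)"
      using mfps_nth_power_eq_0[OF assms(1)] by (simp add: order_ge_def)
    from order_ge_mult[OF order_ge_0 this] show ?thesis
      using that assms(2) by (simp add: order_ge_def)
  qed
  hence "{n. mfps_nth (fps_nth F n * \<phi> ^ n) \<alpha> \<noteq> 0} \<subseteq> {..N}"
    by (auto intro: leI)
  from Sum_any.expand_superset[OF finite_atMost this] show ?thesis
    by (simp add: subst_z_def mfps_nth_sum)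
qed

lemma subst_z_truncate:
  assumes "mfps_nth \<phi> 0 = 0"
  shows "order_ge (Suc N) (subst_z F \<phi> - (\<Sum>n\<le>N. fps_nth F n * \<phi> ^ n))"
  using mfps_nth_subst_z[OF assms, of _ N F] by (simp add: order_ge_def)

text \<open>
  One step of Horner's scheme. Applied to all tails of \<open>F\<close>, it is what makes division by \<open>z - \<phi>\<close>
  work; both sides agree because their truncations at any degree do.
\<close>

lemma subst_z_unfold:
  assumes "mfps_nth \<phi> 0 = 0"
  shows "subst_z F \<phi> = fps_nth F 0 + \<phi> * subst_z (fps_shift 1 F) \<phi>"
proof -
  have "subst_z F \<phi> - (fps_nth F 0 + \<phi> * subst_z (fps_shift 1 F) \<phi>) = 0"
  proof (rule order_ge_all_imp_0)
    fix N
    let ?P = "\<Sum>n\<le>Suc N. fps_nth F n * \<phi> ^ n"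
    let ?S = "\<Sum>n\<le>N. fps_nth (fps_shift 1 F) n * \<phi> ^ n"
    have "?P = fps_nth F 0 + \<phi> * ?S"
      by (subst sum.atMost_Suc_shift) (simp add: sum_distrib_left mult_ac)
    hence "subst_z F \<phi> - (fps_nth F 0 + \<phi> * subst_z (fps_shift 1 F) \<phi>)
        = (subst_z F \<phi> - ?P) - \<phi> * (subst_z (fps_shift 1 F) \<phi> - ?S)"
      by (simp add: algebra_simps)
    moreover have "order_ge N (subst_z F \<phi> - ?P)"
      by (rule order_ge_mono[OF subst_z_truncate[OF assms]]) simp
    moreover have "order_ge N (\<phi> * (subst_z (fps_shift 1 F) \<phi> - ?S))"
      by (rule order_ge_mono[OF order_ge_mult[OF order_ge_0 subst_z_truncate[OF assms]]]) simp
    ultimately show "order_ge N (subst_z F \<phi> - (fps_nth F 0 + \<phi> * subst_z (fps_shift 1 F) \<phi>))"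
      by (simp only: order_ge_diff)
  qed
  thus ?thesis by simp
qed

lemma mfps_nth_subst_z_0:
  assumes "mfps_nth \<phi> 0 = 0"
  shows "mfps_nth (subst_z F \<phi>) 0 = zw_coeff F 0 0"
  by (subst subst_z_unfold[OF assms]) (simp add: mfps_nth_mult_0 assms zw_coeff_def)

lemma subst_z_at_0: "subst_z F 0 = fps_nth F 0"
  by (subst subst_z_unfold) simp_all

lemma subst_z_fps_X_mult:
  assumes "mfps_nth \<phi> 0 = 0"
  shows "subst_z (fps_X * F) \<phi> = \<phi> * subst_z F \<phi>"
proof -
  have "fps_shift 1 (fps_X * F) = F" by (rule fps_ext) simp
  thus ?thesis by (subst subst_z_unfold[OF assms]) simp
qed

lemma subst_z_fps_const_mult:
  assumes "mfps_nth \<phi> 0 = 0"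
  shows "subst_z (fps_const c * F) \<phi> = c * subst_z F \<phi>"
proof -
  have "subst_z (fps_const c * F) \<phi> - c * subst_z F \<phi> = 0"
  proof (rule order_ge_all_imp_0)
    fix N
    let ?P = "\<Sum>n\<le>N. fps_nth F n * \<phi> ^ n"
    have "subst_z (fps_const c * F) \<phi> - c * subst_z F \<phi>
        = (subst_z (fps_const c * F) \<phi> - (\<Sum>n\<le>N. fps_nth (fps_const c * F) n * \<phi> ^ n))
          - c * (subst_z F \<phi> - ?P)"
      by (simp add: sum_distrib_left algebra_simps)
    moreover have "order_ge N (c * (subst_z F \<phi> - ?P))"
      by (rule order_ge_mono[OF order_ge_mult[OF order_ge_0 subst_z_truncate[OF assms]]]) simp
    moreover have "order_ge N (subst_z (fps_const c * F) \<phi>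
        - (\<Sum>n\<le>N. fps_nth (fps_const c * F) n * \<phi> ^ n))"
      by (rule order_ge_mono[OF subst_z_truncate[OF assms]]) simp
    ultimately show "order_ge N (subst_z (fps_const c * F) \<phi> - c * subst_z F \<phi>)"
      by (simp only: order_ge_diff)
  qed
  thus ?thesis by simp
qed

lemma subst_z_diff:
  assumes "mfps_nth \<phi> 0 = 0"
  shows "subst_z (F - H) \<phi> = subst_z F \<phi> - subst_z H \<phi>"
  by (rule mfps_eqI)
     (simp add: mfps_nth_subst_z[OF assms order_refl] mfps_nth_sum left_diff_distrib sum_subtractf)

lemma subst_z_fps_const:
  assumes "mfps_nth \<phi> 0 = 0"
  shows "subst_z (fps_const c) \<phi> = c"
proof -
  \<comment> \<open>The tail is zero, written as a multiple by \<open>0\<close> so that linearity evaluates it.\<close>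
  have "fps_shift 1 (fps_const c) = fps_const 0 * fps_const c"
    by (rule fps_ext) simp
  thus ?thesis
    by (subst subst_z_unfold[OF assms])
      (simp add: subst_z_fps_const_mult[OF assms] del: fps_const_mult fps_const_0_eq_0)
qed

lemma subst_z_fps_X:
  assumes "mfps_nth \<phi> 0 = 0"
  shows "subst_z fps_X \<phi> = \<phi>"
  using subst_z_fps_X_mult[OF assms, of "fps_const 1"] subst_z_fps_const[OF assms, of 1] by simp

lemma w_series_mult:
  assumes "f \<in> w_series I" "g \<in> w_series I"
  shows "f * g \<in> w_series I"
  unfolding w_series_def
proof (intro CollectI allI impI)
  fix \<alpha>
  assume "mfps_nth (f * g) \<alpha> \<noteq> 0"
  then obtain \<beta> \<gamma> where "(\<beta>, \<gamma>) \<in> splits \<alpha>" "mfps_nth f \<beta> \<noteq> 0" "mfps_nth g \<gamma> \<noteq> 0"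
    unfolding mfps_nth_mult by (force elim: sum.not_neutral_contains_not_neutral)
  hence "\<alpha> = \<beta> + \<gamma>" "Poly_Mapping.keys \<beta> \<subseteq> I" "Poly_Mapping.keys \<gamma> \<subseteq> I"
    using assms by (auto simp: w_series_def splits_def)
  thus "Poly_Mapping.keys \<alpha> \<subseteq> I"
    using Poly_Mapping.keys_add[of \<beta> \<gamma>] by blast
qed

lemma w_series_power: "f \<in> w_series I \<Longrightarrow> f ^ n \<in> w_series I"
proof (induction n)
  case 0
  show ?case by (simp add: w_series_def mfps_nth_one)
qed (simp add: w_series_mult)

lemma subst_z_in_w_series:
  assumes "F \<in> zw_series I" "\<phi> \<in> w_series I" "mfps_nth \<phi> 0 = 0"
  shows "subst_z F \<phi> \<in> w_series I"
  unfolding w_series_def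
proof (intro CollectI allI impI)
  fix \<alpha>
  assume "mfps_nth (subst_z F \<phi>) \<alpha> \<noteq> 0"
  hence "(\<Sum>n\<le>total_degree \<alpha>. mfps_nth (fps_nth F n * \<phi> ^ n) \<alpha>) \<noteq> 0"
    by (simp add: mfps_nth_subst_z[OF assms(3) order_refl] mfps_nth_sum)
  then obtain n where "mfps_nth (fps_nth F n * \<phi> ^ n) \<alpha> \<noteq> 0"
    by (rule sum.not_neutral_contains_not_neutral)
  moreover have "fps_nth F n * \<phi> ^ n \<in> w_series I"
    using assms by (intro w_series_mult w_series_power) (auto simp: zw_series_def)
  ultimately show "Poly_Mapping.keys \<alpha> \<subseteq> I"
    by (auto simp: w_series_def)
qed

text \<open>
  The quotient of \<open>F - F(\<phi>)\<close> by \<open>z - \<phi>\<close>, in the form that synthetic division gives it: each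
  coefficient is the value at \<open>\<phi>\<close> of the tail of \<open>F\<close> that lies beyond it.
\<close>

definition subst_quotient :: "('i, 'a::comm_ring_1) mfps fps \<Rightarrow> ('i, 'a) mfps \<Rightarrow> ('i, 'a) mfps fps" where
  "subst_quotient F \<phi> = Abs_fps (\<lambda>n. subst_z (fps_shift (Suc n) F) \<phi>)"

lemma factor_theorem:
  assumes "mfps_nth \<phi> 0 = 0"
  shows "F - fps_const (subst_z F \<phi>) = (fps_X - fps_const \<phi>) * subst_quotient F \<phi>"
proof (rule fps_ext)
  fix n
  have "subst_z (fps_shift n F) \<phi> = fps_nth F n + \<phi> * subst_z (fps_shift (Suc n) F) \<phi>"
    by (subst subst_z_unfold[OF assms]) (simp add: fps_shift_fps_shift[symmetric] add.commute)
  thus "fps_nth (F - fps_const (subst_z F \<phi>)) n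
      = fps_nth ((fps_X - fps_const \<phi>) * subst_quotient F \<phi>) n"
    by (cases n) (simp_all add: left_diff_distrib subst_quotient_def)
qed

lemma zw_coeff_subst_quotient_0:
  assumes "mfps_nth \<phi> 0 = 0"
  shows "zw_coeff (subst_quotient F \<phi>) 0 0 = zw_coeff F 1 0"
  using mfps_nth_subst_z_0[OF assms, of "fps_shift 1 F"]
  by (simp add: zw_coeff_def subst_quotient_def)

text \<open>
  A mean value statement: to lowest order, the difference quotient of \<open>F\<close> is its linear coefficient.
  It comes from substituting \<open>\<psi>\<close> into the factorization of \<open>F - F(\<phi>)\<close>.
\<close>

lemma subst_z_difference:
  assumes "mfps_nth \<phi> 0 = 0" "mfps_nth \<psi> 0 = 0"
  obtains q where "subst_z F \<psi> - subst_z F \<phi> = (\<psi> - \<phi>) * q" "mfps_nth q 0 = zw_coeff F 1 0"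
proof
  let ?q = "subst_z (subst_quotient F \<phi>) \<psi>"
  have "subst_z (F - fps_const (subst_z F \<phi>)) \<psi>
      = subst_z (fps_X * subst_quotient F \<phi> - fps_const \<phi> * subst_quotient F \<phi>) \<psi>"
    by (simp add: factor_theorem[OF assms(1)] left_diff_distrib)
  thus "subst_z F \<psi> - subst_z F \<phi> = (\<psi> - \<phi>) * ?q"
    by (simp add: subst_z_diff subst_z_fps_const subst_z_fps_const_mult subst_z_fps_X_mult assms
          left_diff_distrib)
  show "mfps_nth ?q 0 = zw_coeff F 1 0"
    by (simp add: mfps_nth_subst_z_0[OF assms(2)] zw_coeff_subst_quotient_0[OF assms(1)])
qed

lemma zw_unit:
  fixes F :: "('i, 'a::field) mfps fps"
  assumes "zw_coeff F 0 0 \<noteq> 0"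
  obtains F' where "F * F' = 1"
proof -
  \<comment> \<open>Up to the scalar \<open>c\<close>, the coefficient of \<open>z^0\<close> is \<open>1 - g\<close>; its inverse is the geometric
    series in \<open>g\<close>, obtained by substituting \<open>g\<close> into \<open>1 / (1 - z)\<close>.\<close>
  define c where "c = mfps_nth (fps_nth F 0) 0"
  have c: "c \<noteq> 0" using assms by (simp add: c_def zw_coeff_def)
  define g where "g = 1 - mfps_const (1 / c) * fps_nth F 0"
  have g: "mfps_nth g 0 = 0"
    using c by (simp add: g_def mfps_nth_one c_def)
  define S where "S = subst_z (Abs_fps (\<lambda>_. 1)) g"
  have sh: "fps_shift (Suc 0) (Abs_fps (\<lambda>_. 1)) = (Abs_fps (\<lambda>_. 1) :: ('i, 'a) mfps fps)"
    by (rule fps_ext) simp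
  have "S = 1 + g * S"
    unfolding S_def by (subst subst_z_unfold[OF g]) (simp add: sh)
  hence "fps_nth F 0 * (mfps_const (1 / c) * S) = 1"
    by (simp add: g_def algebra_simps)
  from fps_right_inverse[OF this] that show ?thesis by blast
qed

section \<open>Diagonal coefficients of powers\<close>

lemma zw_coeff_mult:
  "zw_coeff (F * G) n \<alpha> =
     (\<Sum>k\<le>n. \<Sum>(\<beta>, \<gamma>)\<in>splits \<alpha>. zw_coeff F k \<beta> * zw_coeff G (n - k) \<gamma>)"
  by (simp add: zw_coeff_def fps_mult_nth mfps_nth_sum mfps_nth_mult atMost_atLeast0)

lemma zw_coeff_add: "zw_coeff (F + G) n \<alpha> = zw_coeff F n \<alpha> + zw_coeff G n \<alpha>"
  by (simp add: zw_coeff_def)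

lemma zw_coeff_of_nat_mult: "zw_coeff (of_nat k * F) n \<alpha> = of_nat k * zw_coeff F n \<alpha>"
  by (simp add: zw_coeff_def fps_of_nat[symmetric] of_nat_mfps)

text \<open>
  A factor \<open>2\<close> on the \<open>w\<close>-degree puts \<open>z\<close> alone in weight one. This isolates the linear
  term \<open>a z\<close> of a series without constant term from everything else, pure \<open>w\<close>-terms included.
\<close>

definition weight_ge :: "nat \<Rightarrow> ('i, 'a::comm_ring_1) mfps fps \<Rightarrow> bool" where
  "weight_ge d F \<longleftrightarrow> (\<forall>n \<alpha>. n + 2 * total_degree \<alpha> < d \<longrightarrow> zw_coeff F n \<alpha> = 0)"

lemma weight_ge_0 [simp]: "weight_ge 0 F"
  by (simp add: weight_ge_def)

lemma weight_ge_mult: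
  assumes "weight_ge d F" "weight_ge e G"
  shows "weight_ge (d + e) (F * G)"
  unfolding weight_ge_def
proof (intro allI impI)
  fix n and \<alpha> :: "'a \<Rightarrow>\<^sub>0 nat"
  assume n: "n + 2 * total_degree \<alpha> < d + e"
  have "zw_coeff F k \<beta> * zw_coeff G (n - k) \<gamma> = 0" if "k \<le> n" "(\<beta>, \<gamma>) \<in> splits \<alpha>" for k \<beta> \<gamma>
  proof -
    have "k + 2 * total_degree \<beta> < d \<or> (n - k) + 2 * total_degree \<gamma> < e"
      using that n by (auto simp: splits_def total_degree_add)
    thus ?thesis using assms by (auto simp: weight_ge_def)
  qed
  thus "zw_coeff (F * G) n \<alpha> = 0"
    unfolding zw_coeff_mult by (intro sum.neutral ballI) (auto intro!: sum.neutral)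
qed

lemma weight_ge_power: "weight_ge d F \<Longrightarrow> weight_ge (k * d) (F ^ k)"
  by (induction k) (auto simp: weight_ge_mult)

lemma zw_coeff_mult_linear_power:
  "zw_coeff (F * (fps_const (mfps_const a) * fps_X) ^ k) n \<alpha> =
     (if k \<le> n then a ^ k * zw_coeff F (n - k) \<alpha> else 0)"
proof -
  have "F * (fps_const (mfps_const a) * fps_X) ^ k = fps_const (mfps_const (a ^ k)) * (F * fps_X ^ k)"
    by (simp add: power_mult_distrib mfps_const_power mult_ac)
  thus ?thesis
    by (simp add: zw_coeff_def fps_X_power_mult_right_nth)
qed

text \<open>
  The monomial \<open>z^j w^\<alpha>\<close> has weight \<open>j + 2|\<alpha>|\<close>, whereas \<open>H B^j\<close> has only weights \<open>\<ge> 2j\<close>. This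
  is why the range of \<open>j\<close> is bounded independently of \<open>m\<close>, and all dependence on \<open>m\<close> is explicit.
\<close>

lemma diagonal_coeff_expansion:
  assumes B: "weight_ge 2 B"
  shows "zw_coeff (H * (fps_const (mfps_const a) * fps_X + B) ^ m) m \<alpha> =
    (\<Sum>j\<le>2 * total_degree \<alpha>. of_nat (m choose j) * a ^ (m - j) * zw_coeff (H * B ^ j) j \<alpha>)"
proof -
  let ?L = "fps_const (mfps_const a) * fps_X"
  define t where "t = (\<lambda>j. of_nat (m choose j) * a ^ (m - j) * zw_coeff (H * B ^ j) j \<alpha>)"
  have "H * (?L + B) ^ m = (\<Sum>j\<le>m. of_nat (m choose j) * ((H * B ^ j) * ?L ^ (m - j)))"
    unfolding add.commute[of ?L] binomial_ring sum_distrib_left by (simp only: mult_ac)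
  hence "zw_coeff (H * (?L + B) ^ m) m \<alpha>
      = (\<Sum>j\<le>m. zw_coeff (of_nat (m choose j) * ((H * B ^ j) * ?L ^ (m - j))) m \<alpha>)"
    by (simp add: zw_coeff_def fps_sum_nth mfps_nth_sum)
  also have "\<dots> = (\<Sum>j\<le>m. t j)"
    unfolding zw_coeff_of_nat_mult zw_coeff_mult_linear_power t_def by (simp add: mult.assoc)
  also have "\<dots> = (\<Sum>j\<le>2 * total_degree \<alpha>. t j)"
  proof -
    have "t j = 0" if "j > m" for j
      using that by (simp add: t_def binomial_eq_0)
    moreover have "t j = 0" if "j > 2 * total_degree \<alpha>" for j
      using weight_ge_mult[OF weight_ge_0 weight_ge_power[OF B, of j], of H] that
      by (simp add: t_def weight_ge_def)
    ultimately have "sum t {..max m (2 * total_degree \<alpha>)} = sum t {..m}"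
      "sum t {..max m (2 * total_degree \<alpha>)} = sum t {..2 * total_degree \<alpha>}"
      by (intro sum.mono_neutral_right; auto)+
    thus ?thesis by simp
  qed
  finally show ?thesis by (simp add: t_def)
qed

text \<open>
  The power series of \<open>1 / (1 - r)^(j + 1)\<close>, built up by repeated Cauchy products with the geometric
  series.
\<close>

lemma summable_binomial_geometric:
  fixes r :: real
  assumes "0 \<le> r" "r < 1"
  shows "summable (\<lambda>m. real (m choose j) * r ^ (m - j))"
proof -
  have "summable (\<lambda>i. real (j + i choose j) * r ^ i)"
  proof (induction j)
    case 0
    show ?case using assms by (simp add: summable_geometric)
  next
    case (Suc j)
    have "(\<Sum>k\<le>i. real (j + k choose j) * r ^ k * r ^ (i - k)) =
        real (Suc j + i choose Suc j) * r ^ i" for i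
    proof -
      have "(\<Sum>k\<le>i. real (j + k choose j) * r ^ k * r ^ (i - k)) =
          real (\<Sum>k\<le>i. j + k choose j) * r ^ i"
        by (simp add: sum_distrib_right mult.assoc flip: power_add)
      thus ?thesis by (simp add: choose_rising_sum(1))
    qed
    moreover have "summable (\<lambda>i. \<Sum>k\<le>i. real (j + k choose j) * r ^ k * r ^ (i - k))"
      using Suc assms by (intro summable_Cauchy_product) (simp_all add: summable_geometric)
    ultimately show ?case by simp
  qed
  hence "summable (\<lambda>i. real (i + j choose j) * r ^ (i + j - j))"
    by (simp add: add.commute)
  from this summable_iff_shift[of "\<lambda>m. real (m choose j) * r ^ (m - j)" j] show ?thesis by simp
qed

lemma summable_norm_diagonal:
  fixes G :: "('i, 'a::{real_normed_field, banach}) mfps fps"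
  assumes "zw_coeff G 0 0 = 0" "norm (zw_coeff G 1 0) < 1"
  shows "summable (\<lambda>m. norm (zw_coeff (H * G ^ m) m \<alpha>))"
proof -
  define a where "a = zw_coeff G 1 0"
  define B where "B = G - fps_const (mfps_const a) * fps_X"
  have "weight_ge 2 B"
    unfolding weight_ge_def
  proof (intro allI impI)
    fix n and \<alpha> :: "'i \<Rightarrow>\<^sub>0 nat"
    assume "n + 2 * total_degree \<alpha> < 2"
    hence "total_degree \<alpha> = 0" "n = 0 \<or> n = 1" by auto
    thus "zw_coeff B n \<alpha> = 0"
      using assms(1) by (auto simp: total_degree_eq_0_iff B_def a_def zw_coeff_def mfps_nth_const)
  qed
  hence eq: "zw_coeff (H * G ^ m) m \<alpha> =
    (\<Sum>j\<le>2 * total_degree \<alpha>. of_nat (m choose j) * a ^ (m - j) * zw_coeff (H * B ^ j) j \<alpha>)" for m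
    using diagonal_coeff_expansion[of B H a m \<alpha>] by (simp add: B_def)
  have "summable (\<lambda>m. \<Sum>j\<le>2 * total_degree \<alpha>.
      real (m choose j) * norm a ^ (m - j) * norm (zw_coeff (H * B ^ j) j \<alpha>))"
    using assms(2) by (intro summable_sum summable_mult2 summable_binomial_geometric) (auto simp: a_def)
  thus ?thesis
  proof (rule summable_comparison_test'[where N = 0])
    fix m
    show "norm (norm (zw_coeff (H * G ^ m) m \<alpha>)) \<le> (\<Sum>j\<le>2 * total_degree \<alpha>.
      real (m choose j) * norm a ^ (m - j) * norm (zw_coeff (H * B ^ j) j \<alpha>))"
      unfolding eq real_norm_def abs_norm_cancel
      by (rule order_trans[OF norm_sum]) (simp add: norm_mult norm_power)
  qed
qed

section \<open>The diagonal functional\<close>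

context
  fixes G :: "('i, 'a::{real_normed_field, banach}) mfps fps"
  assumes G_0: "zw_coeff G 0 0 = 0" and G_1: "norm (zw_coeff G 1 0) < 1"
begin

definition diagonal_sum :: "('i, 'a) mfps fps \<Rightarrow> ('i, 'a) mfps" where
  "diagonal_sum H = Abs_mfps (\<lambda>\<alpha>. suminf (\<lambda>m. zw_coeff (H * G ^ m) m \<alpha>))"

lemma diagonal_sums: "(\<lambda>m. zw_coeff (H * G ^ m) m \<alpha>) sums mfps_nth (diagonal_sum H) \<alpha>"
  using summable_norm_cancel[OF summable_norm_diagonal[OF G_0 G_1], of H \<alpha>]
  by (simp add: diagonal_sum_def summable_sums)

lemma diagonal_sum_add: "diagonal_sum (F + H) = diagonal_sum F + diagonal_sum H"
proof (rule mfps_eqI)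
  fix \<alpha>
  have "(\<lambda>m. zw_coeff ((F + H) * G ^ m) m \<alpha>) sums
      (mfps_nth (diagonal_sum F) \<alpha> + mfps_nth (diagonal_sum H) \<alpha>)"
    using sums_add[OF diagonal_sums diagonal_sums, of F \<alpha> H \<alpha>]
    by (simp add: distrib_right zw_coeff_add)
  from sums_unique2[OF diagonal_sums this]
  show "mfps_nth (diagonal_sum (F + H)) \<alpha> = mfps_nth (diagonal_sum F + diagonal_sum H) \<alpha>"
    by simp
qed

lemma diagonal_sum_fps_const_mult: "diagonal_sum (fps_const c * H) = c * diagonal_sum H"
proof (rule mfps_eqI)
  fix \<alpha>
  have "zw_coeff (fps_const c * H * G ^ m) m \<alpha> =
      (\<Sum>(\<beta>, \<gamma>)\<in>splits \<alpha>. mfps_nth c \<beta> * zw_coeff (H * G ^ m) m \<gamma>)" for m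
    by (simp add: zw_coeff_def mult.assoc mfps_nth_mult)
  moreover have "(\<lambda>m. \<Sum>(\<beta>, \<gamma>)\<in>splits \<alpha>. mfps_nth c \<beta> * zw_coeff (H * G ^ m) m \<gamma>) sums
      (\<Sum>(\<beta>, \<gamma>)\<in>splits \<alpha>. mfps_nth c \<beta> * mfps_nth (diagonal_sum H) \<gamma>)"
    unfolding case_prod_unfold by (intro sums_sum sums_mult diagonal_sums)
  ultimately show "mfps_nth (diagonal_sum (fps_const c * H)) \<alpha> = mfps_nth (c * diagonal_sum H) \<alpha>"
    using sums_unique2[OF diagonal_sums, of "fps_const c * H" \<alpha>] by (simp add: mfps_nth_mult)
qed

text \<open>
  The terms of \<open>M(z H)\<close> are those of \<open>M(G H)\<close> moved by one place, since
  \<open>[z^(m+1)] z H G^(m+1) = [z^m] (G H) G^m\<close>, and the term that is left over vanishes.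
\<close>

lemma diagonal_sum_kernel: "diagonal_sum ((fps_X - G) * H) = 0"
proof (rule mfps_eqI)
  fix \<alpha>
  define u where "u = (\<lambda>m. zw_coeff (fps_X * H * G ^ m) m \<alpha>)"
  have "u 0 = 0"
    by (simp add: u_def zw_coeff_def)
  moreover have "u (Suc m) = zw_coeff (G * H * G ^ m) m \<alpha>" for m
    by (simp add: u_def zw_coeff_def mult.assoc mult.left_commute)
  moreover have "u sums mfps_nth (diagonal_sum (fps_X * H)) \<alpha>"
    unfolding u_def by (rule diagonal_sums)
  ultimately have "(\<lambda>m. zw_coeff (G * H * G ^ m) m \<alpha>) sums mfps_nth (diagonal_sum (fps_X * H)) \<alpha>"
    using sums_Suc_iff[of u] by simp
  hence "mfps_nth (diagonal_sum (fps_X * H)) \<alpha> = mfps_nth (diagonal_sum (G * H)) \<alpha>"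
    by (rule sums_unique2[OF _ diagonal_sums])
  moreover have "diagonal_sum (fps_X * H) = diagonal_sum ((fps_X - G) * H) + diagonal_sum (G * H)"
    by (simp add: diagonal_sum_add[symmetric] algebra_simps)
  ultimately show "mfps_nth (diagonal_sum ((fps_X - G) * H)) \<alpha> = mfps_nth 0 \<alpha>"
    by simp
qed

text \<open>
  Dividing \<open>G - \<phi>\<close> by \<open>z - \<phi>\<close> shows that \<open>z - G\<close> and \<open>z - \<phi>\<close> differ by a factor whose constant
  term is \<open>1 - a\<close>, hence by a unit. The two series therefore generate the same ideal.
\<close>

lemma fixed_point_factor:
  assumes "mfps_nth \<phi> 0 = 0" "\<phi> = subst_z G \<phi>"
  obtains U where "fps_X - fps_const \<phi> = (fps_X - G) * U"
proof -
  let ?Q = "subst_quotient G \<phi>"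
  have "zw_coeff (1 - ?Q) 0 0 \<noteq> 0"
    using G_1 zw_coeff_subst_quotient_0[OF assms(1), of G]
    by (auto simp: zw_coeff_def mfps_nth_one)
  then obtain U where U: "(1 - ?Q) * U = 1"
    by (rule zw_unit)
  have "fps_X - G = (fps_X - fps_const \<phi>) * (1 - ?Q)"
    using factor_theorem[OF assms(1), of G] assms(2) by (simp add: algebra_simps)
  hence "(fps_X - G) * U = fps_X - fps_const \<phi>"
    by (simp add: mult.assoc U)
  thus ?thesis using that by metis
qed

text \<open>
  Modulo the ideal of \<open>z - G\<close>, which \<^const>\<open>diagonal_sum\<close> annihilates, \<open>H\<close> is congruent to its value
  at the fixed point.
\<close>

lemma diagonal_sum_mult:
  assumes "mfps_nth \<phi> 0 = 0" "\<phi> = subst_z G \<phi>"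
  shows "diagonal_sum (H * F) = subst_z H \<phi> * diagonal_sum F"
proof -
  obtain U where U: "fps_X - fps_const \<phi> = (fps_X - G) * U"
    using fixed_point_factor[OF assms] .
  have "H = fps_const (subst_z H \<phi>) + (fps_X - fps_const \<phi>) * subst_quotient H \<phi>"
    using factor_theorem[OF assms(1), of H] by (simp add: algebra_simps)
  hence "H * F = fps_const (subst_z H \<phi>) * F + (fps_X - G) * (U * subst_quotient H \<phi> * F)"
    unfolding U by (metis (no_types, lifting) distrib_right mult.assoc)
  thus ?thesis
    by (simp add: diagonal_sum_add diagonal_sum_fps_const_mult diagonal_sum_kernel)
qed

abbreviation (input) lagrange_term :: "('i, 'a) mfps fps \<Rightarrow> ('i \<Rightarrow>\<^sub>0 nat) \<Rightarrow> nat \<Rightarrow> 'a" where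
  "lagrange_term H \<alpha> m \<equiv> 1 / of_nat m * zw_coeff (fps_deriv H * G ^ m) (m - 1) \<alpha>"

text \<open>
  The coefficient of \<open>z^m\<close> in \<open>(H G^(m+1))'\<close>, computed by the product rule and read off from
  \<open>H G^(m+1)\<close> directly. In this form no factor \<open>1/m\<close> is left, and both parts are diagonal
  coefficients.
\<close>

lemma lagrange_term_Suc:
  "lagrange_term H \<alpha> (Suc m) =
    zw_coeff (H * G ^ Suc m) (Suc m) \<alpha> - zw_coeff (H * fps_deriv G * G ^ m) m \<alpha>"
proof -
  have "fps_deriv (H * G ^ Suc m) =
      of_nat (Suc m) * (H * fps_deriv G * G ^ m) + fps_deriv H * G ^ Suc m"
    by (simp add: fps_deriv_power' algebra_simps del: power_Suc of_nat_Suc)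
  moreover have "zw_coeff (fps_deriv (H * G ^ Suc m)) m \<alpha> =
      of_nat (Suc m) * zw_coeff (H * G ^ Suc m) (Suc m) \<alpha>"
    by (simp add: zw_coeff_def of_nat_mfps del: power_Suc of_nat_Suc fps_deriv_mult)
  ultimately have "of_nat (Suc m) * zw_coeff (H * G ^ Suc m) (Suc m) \<alpha> =
      of_nat (Suc m) * zw_coeff (H * fps_deriv G * G ^ m) m \<alpha> +
      zw_coeff (fps_deriv H * G ^ Suc m) m \<alpha>"
    by (simp add: zw_coeff_add zw_coeff_of_nat_mult del: power_Suc of_nat_Suc fps_deriv_mult)
  thus ?thesis
    by (simp add: field_simps del: power_Suc of_nat_Suc)
qed

lemma summable_norm_lagrange_term: "summable (\<lambda>m. norm (lagrange_term H \<alpha> (Suc m)))"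
proof (rule summable_comparison_test'[where N = 0])
  show "summable (\<lambda>m. norm (zw_coeff (H * G ^ Suc m) (Suc m) \<alpha>)
      + norm (zw_coeff (H * fps_deriv G * G ^ m) m \<alpha>))"
    using summable_norm_diagonal[OF G_0 G_1, of H \<alpha>]
    by (intro summable_add summable_norm_diagonal[OF G_0 G_1])
      (simp only: summable_Suc_iff[of "\<lambda>m. norm (zw_coeff (H * G ^ m) m \<alpha>)"])
  show "norm (norm (lagrange_term H \<alpha> (Suc m))) \<le> norm (zw_coeff (H * G ^ Suc m) (Suc m) \<alpha>)
      + norm (zw_coeff (H * fps_deriv G * G ^ m) m \<alpha>)" for m
    unfolding lagrange_term_Suc real_norm_def abs_norm_cancel by (rule norm_triangle_ineq4)
qed

lemma lagrange_term_sums: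
  "(\<lambda>m. lagrange_term H \<alpha> (Suc m)) sums
     (mfps_nth (diagonal_sum (H * (1 - fps_deriv G))) \<alpha> - zw_coeff H 0 \<alpha>)"
proof -
  have "(\<lambda>m. zw_coeff (H * G ^ Suc m) (Suc m) \<alpha>) sums
      (mfps_nth (diagonal_sum H) \<alpha> - zw_coeff H 0 \<alpha>)"
    using diagonal_sums[of H \<alpha>] by (subst sums_Suc_iff) simp
  from sums_diff[OF this diagonal_sums[of "H * fps_deriv G"]]
  have "(\<lambda>m. lagrange_term H \<alpha> (Suc m)) sums
      (mfps_nth (diagonal_sum H) \<alpha> - zw_coeff H 0 \<alpha>
        - mfps_nth (diagonal_sum (H * fps_deriv G)) \<alpha>)"
    unfolding lagrange_term_Suc .
  moreover have "diagonal_sum H = diagonal_sum (H * (1 - fps_deriv G)) + diagonal_sum (H * fps_deriv G)"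
    by (simp add: diagonal_sum_add[symmetric] algebra_simps)
  ultimately show ?thesis by simp
qed

text \<open>
  The Lagrange sum for \<open>H = 1\<close> consists of zeros, which determines the value of the functional at
  \<open>1 - G'\<close> without any computation.
\<close>

lemma diagonal_sum_normalization: "diagonal_sum (1 - fps_deriv G) = 1"
proof (rule mfps_eqI)
  fix \<alpha>
  have "(\<lambda>m. 0) sums (mfps_nth (diagonal_sum (1 - fps_deriv G)) \<alpha> - mfps_nth 1 \<alpha>)"
    using lagrange_term_sums[of 1 \<alpha>] by (simp add: zw_coeff_def)
  from sums_unique2[OF this sums_zero]
  show "mfps_nth (diagonal_sum (1 - fps_deriv G)) \<alpha> = mfps_nth 1 \<alpha>" by simp
qed

lemma lagrange_inversion_has_sum:
  assumes "mfps_nth \<phi> 0 = 0" "\<phi> = subst_z G \<phi>"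
  shows "lagrange_term H \<alpha> abs_summable_on {1..}"
    and "(lagrange_term H \<alpha> has_sum (mfps_nth (subst_z H \<phi>) \<alpha> - mfps_nth (subst_z H 0) \<alpha>)) {1..}"
proof -
  have Suc: "bij_betw Suc UNIV {1..}"
    by (rule bij_betw_byWitness[where f' = "\<lambda>m. m - 1"]) auto
  have "(\<lambda>m. lagrange_term H \<alpha> (Suc m)) sums (mfps_nth (subst_z H \<phi>) \<alpha> - mfps_nth (subst_z H 0) \<alpha>)"
    using lagrange_term_sums[of H \<alpha>]
    by (simp only: diagonal_sum_mult[OF assms] diagonal_sum_normalization subst_z_at_0 zw_coeff_def
        mult_1_right)
  hence "((\<lambda>m. lagrange_term H \<alpha> (Suc m)) has_sum
      (mfps_nth (subst_z H \<phi>) \<alpha> - mfps_nth (subst_z H 0) \<alpha>)) UNIV"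
    by (rule norm_summable_imp_has_sum[OF summable_norm_lagrange_term])
  thus "(lagrange_term H \<alpha> has_sum (mfps_nth (subst_z H \<phi>) \<alpha> - mfps_nth (subst_z H 0) \<alpha>)) {1..}"
    by (rule iffD1[OF has_sum_reindex_bij_betw[OF Suc]])
  have "(\<lambda>m. norm (lagrange_term H \<alpha> (Suc m))) summable_on UNIV"
    using summable_norm_lagrange_term by (simp only: summable_on_UNIV_nonneg_real_iff norm_ge_zero)
  thus "lagrange_term H \<alpha> abs_summable_on {1..}"
    by (simp only: summable_on_reindex_bij_betw[OF Suc, of "\<lambda>m. norm (lagrange_term H \<alpha> m)"])
qed

corollary lagrange_inversion_fps_X:
  assumes "mfps_nth \<phi> 0 = 0" "\<phi> = subst_z G \<phi>"
  shows "((\<lambda>m. 1 / of_nat m * zw_coeff (G ^ m) (m - 1) \<alpha>) has_sum mfps_nth \<phi> \<alpha>) {1..}"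
  using lagrange_inversion_has_sum(2)[OF assms, of fps_X \<alpha>]
  by (simp add: subst_z_fps_X assms(1) subst_z_at_0)

corollary fixed_point_unique:
  assumes "mfps_nth \<phi> 0 = 0" "\<phi> = subst_z G \<phi>" "mfps_nth \<psi> 0 = 0" "\<psi> = subst_z G \<psi>"
  shows "\<phi> = \<psi>"
  using lagrange_inversion_fps_X[OF assms(1,2)] lagrange_inversion_fps_X[OF assms(3,4)]
  by (intro mfps_eqI) (rule has_sum_unique)

section \<open>Existence of the fixed point\<close>

text \<open>
  Plain iteration of \<open>G\<close> does not stabilize coefficientwise when \<open>a \<noteq> 0\<close>. One step of Newton's method
  for \<open>\<phi> - G(\<phi>) = 0\<close>, with the derivative replaced by its constant term \<open>1 - a\<close>, cancels the linear
  part of the error, so that coefficients become final degree by degree.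
\<close>

definition newton_step :: "('i, 'a) mfps \<Rightarrow> ('i, 'a) mfps" where
  "newton_step \<phi> = \<phi> + mfps_const (1 / (1 - zw_coeff G 1 0)) * (subst_z G \<phi> - \<phi>)"

lemma newton_step_fixed_iff: "newton_step \<phi> = \<phi> \<longleftrightarrow> \<phi> = subst_z G \<phi>"
proof
  have "1 - zw_coeff G 1 0 \<noteq> 0" using G_1 by auto
  assume "newton_step \<phi> = \<phi>"
  hence eq: "mfps_const (1 / (1 - zw_coeff G 1 0)) * (subst_z G \<phi> - \<phi>) = 0"
    by (simp add: newton_step_def)
  show "\<phi> = subst_z G \<phi>"
  proof (rule mfps_eqI)
    fix \<alpha>
    show "mfps_nth \<phi> \<alpha> = mfps_nth (subst_z G \<phi>) \<alpha>"
      using arg_cong[OF eq, of "\<lambda>f. mfps_nth f \<alpha>"] \<open>1 - zw_coeff G 1 0 \<noteq> 0\<close> by simp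
  qed
qed (simp add: newton_step_def)

lemma newton_step_nth_0: "mfps_nth \<phi> 0 = 0 \<Longrightarrow> mfps_nth (newton_step \<phi>) 0 = 0"
  using G_0 by (simp add: newton_step_def mfps_nth_subst_z_0)

text \<open>
  The error \<open>\<psi> - \<phi>\<close> is multiplied by \<open>1 + (q - 1) / (1 - a)\<close>, where \<open>q\<close> is the difference quotient
  of \<open>G\<close>. As \<open>q\<close> has constant term \<open>a\<close>, this factor has none.
\<close>

lemma newton_step_contraction:
  assumes "mfps_nth \<phi> 0 = 0" "mfps_nth \<psi> 0 = 0" "order_ge n (\<psi> - \<phi>)"
  shows "order_ge (Suc n) (newton_step \<psi> - newton_step \<phi>)"
proof -
  let ?c = "mfps_const (1 / (1 - zw_coeff G 1 0))"
  obtain q where q: "subst_z G \<psi> - subst_z G \<phi> = (\<psi> - \<phi>) * q" "mfps_nth q 0 = zw_coeff G 1 0"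
    using subst_z_difference[OF assms(1,2)] .
  have "newton_step \<psi> - newton_step \<phi> = \<psi> - \<phi> + ?c * (subst_z G \<psi> - subst_z G \<phi> - (\<psi> - \<phi>))"
    by (simp add: newton_step_def algebra_simps)
  also have "\<dots> = (\<psi> - \<phi>) * (1 + ?c * (q - 1))"
    unfolding q(1) by (simp add: algebra_simps)
  finally have eq: "newton_step \<psi> - newton_step \<phi> = (\<psi> - \<phi>) * (1 + ?c * (q - 1))" .
  have "1 - zw_coeff G 1 0 \<noteq> 0" using G_1 by auto
  hence "order_ge (Suc 0) (1 + ?c * (q - 1))"
    by (simp add: order_ge_1_iff mfps_nth_one q(2)) (simp add: field_simps)
  from order_ge_mult[OF assms(3) this] show ?thesis
    by (simp add: eq)
qed

lemma newton_step_in_w_series: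
  assumes "G \<in> zw_series I" "\<phi> \<in> w_series I" "mfps_nth \<phi> 0 = 0"
  shows "newton_step \<phi> \<in> w_series I"
proof -
  have "subst_z G \<phi> \<in> w_series I"
    using assms by (rule subst_z_in_w_series)
  moreover have "mfps_nth (newton_step \<phi>) \<alpha> = 0"
    if "mfps_nth \<phi> \<alpha> = 0" "mfps_nth (subst_z G \<phi>) \<alpha> = 0" for \<alpha>
    using that by (simp add: newton_step_def)
  ultimately show ?thesis
    using assms(2) unfolding w_series_def by blast
qed

lemma fixed_point_exists:
  assumes "G \<in> zw_series I"
  obtains \<phi> where "\<phi> \<in> w_series I" "mfps_nth \<phi> 0 = 0" "\<phi> = subst_z G \<phi>"
proof -
  define x where "x n = (newton_step ^^ n) 0" for n
  have x_Suc: "x (Suc n) = newton_step (x n)" for n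
    by (simp add: x_def)
  have x: "mfps_nth (x n) 0 = 0" "x n \<in> w_series I" for n
  proof (induction n)
    case 0
    { case 1 show ?case by (simp add: x_def) }
    { case 2 show ?case by (simp add: x_def w_series_def) }
  next
    case (Suc n)
    { case 1 show ?case using Suc by (simp add: x_Suc newton_step_nth_0) }
    { case 2 show ?case using Suc assms by (simp add: x_Suc newton_step_in_w_series) }
  qed
  have step: "order_ge (Suc n) (x (Suc n) - x n)" for n
  proof (induction n)
    case 0
    show ?case by (simp add: order_ge_1_iff x)
  next
    case (Suc n)
    from newton_step_contraction[OF x(1) x(1) this] show ?case
      by (simp only: x_Suc[symmetric])
  qed
  have stable: "order_ge (Suc n) (x (n + k) - x n)" for n k
  proof (induction k)
    case 0
    show ?case by (simp add: order_ge_def)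
  next
    case (Suc k)
    have "order_ge (Suc n) (x (Suc (n + k)) - x (n + k))"
      by (rule order_ge_mono[OF step]) simp
    from order_ge_add[OF this Suc] show ?case by simp
  qed
  \<comment> \<open>The iterates are stationary in total degree \<open>d\<close> from the \<open>d\<close>-th one on.\<close>
  define \<phi> where "\<phi> = Abs_mfps (\<lambda>\<alpha>. mfps_nth (x (total_degree \<alpha>)) \<alpha>)"
  have approx: "order_ge (Suc n) (\<phi> - x n)" for n
    unfolding order_ge_def
  proof (intro allI impI)
    fix \<alpha> :: "'i \<Rightarrow>\<^sub>0 nat"
    assume "total_degree \<alpha> < Suc n"
    then obtain k where "n = total_degree \<alpha> + k"
      by (auto simp: less_Suc_eq_le le_iff_add)
    thus "mfps_nth (\<phi> - x n) \<alpha> = 0"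
      using stable[of "total_degree \<alpha>" k] by (simp add: order_ge_def \<phi>_def)
  qed
  show thesis
  proof
    show "\<phi> \<in> w_series I"
      using x(2) by (auto simp: w_series_def \<phi>_def)
    show \<phi>_0: "mfps_nth \<phi> 0 = 0"
      by (simp add: \<phi>_def x)
    have "newton_step \<phi> - \<phi> = 0"
    proof (rule order_ge_all_imp_0)
      fix n
      have "order_ge n (newton_step \<phi> - newton_step (x n))"
        by (rule order_ge_mono[OF newton_step_contraction[OF x(1) \<phi>_0 approx]]) simp
      moreover have "order_ge n (\<phi> - x (Suc n))"
        by (rule order_ge_mono[OF approx]) simp
      ultimately have "order_ge n ((newton_step \<phi> - newton_step (x n)) - (\<phi> - x (Suc n)))"
        by (rule order_ge_diff)
      thus "order_ge n (newton_step \<phi> - \<phi>)"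
        by (simp add: x_Suc)
    qed
    thus "\<phi> = subst_z G \<phi>"
      using newton_step_fixed_iff[of \<phi>] by simp
  qed
qed

end

theorem theorem3p8:
  fixes I :: "'i set" and G :: "('i, 'a::{real_normed_field, banach}) mfps fps"
  assumes "G \<in> zw_series I"
    and "zw_coeff G 0 0 = 0"
    and "norm (zw_coeff G 1 0) < 1"
  shows "(\<exists>!\<phi>. \<phi> \<in> w_series I \<and> mfps_nth \<phi> 0 = 0 \<and> \<phi> = subst_z G \<phi>) \<and>
    (\<forall>\<phi>. \<phi> \<in> w_series I \<and> mfps_nth \<phi> 0 = 0 \<and> \<phi> = subst_z G \<phi> \<longrightarrow>
      (\<forall>\<alpha>. Poly_Mapping.keys \<alpha> \<subseteq> I \<longrightarrow>
        (\<lambda>m. 1 / of_nat m * zw_coeff (G ^ m) (m - 1) \<alpha>) abs_summable_on {1..} \<and>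
        mfps_nth \<phi> \<alpha> = (\<Sum>\<^sub>\<infinity>m\<in>{1..}. 1 / of_nat m * zw_coeff (G ^ m) (m - 1) \<alpha>)) \<and>
      (\<forall>H \<in> zw_series I. \<forall>\<alpha>. Poly_Mapping.keys \<alpha> \<subseteq> I \<longrightarrow>
        (\<lambda>m. 1 / of_nat m * zw_coeff (fps_deriv H * G ^ m) (m - 1) \<alpha>) abs_summable_on {1..} \<and>
        mfps_nth (subst_z H \<phi>) \<alpha> = mfps_nth (subst_z H 0) \<alpha> +
          (\<Sum>\<^sub>\<infinity>m\<in>{1..}. 1 / of_nat m * zw_coeff (fps_deriv H * G ^ m) (m - 1) \<alpha>)))"
proof (intro conjI allI impI ballI)
  obtain \<phi> where "\<phi> \<in> w_series I" "mfps_nth \<phi> 0 = 0" "\<phi> = subst_z G \<phi>"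
    using fixed_point_exists[OF assms(2,3,1)] .
  thus "\<exists>!\<phi>. \<phi> \<in> w_series I \<and> mfps_nth \<phi> 0 = 0 \<and> \<phi> = subst_z G \<phi>"
    using fixed_point_unique[OF assms(2,3)] by blast
next
  fix \<phi> :: "('i, 'a) mfps" and \<alpha> :: "'i \<Rightarrow>\<^sub>0 nat"
  assume "\<phi> \<in> w_series I \<and> mfps_nth \<phi> 0 = 0 \<and> \<phi> = subst_z G \<phi>"
  hence \<phi>: "mfps_nth \<phi> 0 = 0" "\<phi> = subst_z G \<phi>" by blast+
  note lagrange = lagrange_inversion_has_sum[OF assms(2,3) \<phi>]
  show "(\<lambda>m. 1 / of_nat m * zw_coeff (G ^ m) (m - 1) \<alpha>) abs_summable_on {1..}"
    using lagrange(1)[of fps_X \<alpha>] by simp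
  show "mfps_nth \<phi> \<alpha> = (\<Sum>\<^sub>\<infinity>m\<in>{1..}. 1 / of_nat m * zw_coeff (G ^ m) (m - 1) \<alpha>)"
    by (rule infsumI[symmetric, OF lagrange_inversion_fps_X[OF assms(2,3) \<phi>]])
  fix H :: "('i, 'a) mfps fps"
  show "(\<lambda>m. 1 / of_nat m * zw_coeff (fps_deriv H * G ^ m) (m - 1) \<alpha>) abs_summable_on {1..}"
    by (rule lagrange(1))
  show "mfps_nth (subst_z H \<phi>) \<alpha> = mfps_nth (subst_z H 0) \<alpha> +
      (\<Sum>\<^sub>\<infinity>m\<in>{1..}. 1 / of_nat m * zw_coeff (fps_deriv H * G ^ m) (m - 1) \<alpha>)"
    by (simp only: infsumI[OF lagrange(2)]) simp
qed

end
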